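(* Let $r>0$ be real, $p\in(0,1)$, $q=1-p$, $\mu=rq/p$, and let $t_c$ be the vertex (the unique critical point in $t$) of the quadratic polynomial $$A_1(t;p)=-\frac{p^{2}}{2q}\,B_2(t)-\frac pq\,t-\frac1{12},$$ where $B_2(t)=t^2-t+\tfrac16$. Then $$t_c=-\frac{1+q}{2p}=-\frac qp-\frac12,\qquad\text{so}\qquad \mu+t_c+\tfrac12=\frac{(r-1)q}{p},$$ and the unit window $\bigl(\mu+t_c-\tfrac12,\ \mu+t_c+\tfrac12\bigr]$ contains exactly one integer, $\lfloor(r-1)q/p\rfloor$. This integer is the upper mode of $\mathrm{NB}(r,p)$; two modes occur exactly when the endpoint $(r-1)q/p$ is an integer.
   Context: The negative binomial law $\mathrm{NB}(r,p)$ (failures parametrisation), with $r>0$ real, $p$ in a compact subset of $(0,1)$ and $q=1-p$, has mass function $$P(k)=\frac{\Gamma(k+r)}{\Gamma(r)\,\Gamma(k+1)}\,p^{r}q^{k},\qquad k\in\mathbb{Z}_{\ge0},$$ with mean $\mu=rq/p$ and variance $\sigma^2=rq/p^2$; the surrounding asymptotic setting is $r\to\infty$. A mode is a point $k\in\mathbb{Z}_{\ge0}$ at which $P$ attains its maximum; the upper mode is the largest such point. The polynomial $A_1(t;p)$ is the coefficient of $r^{-1}$ in the complete asymptotic expansion, in powers of $r^{-1}$, of $\log\bigl[\sqrt{2\pi\sigma^2}\,P(\mu+t)\bigr]$ as $r\to\infty$, with $t$ in a fixed compact set and $\mu+t\in\mathbb{Z}_{\ge0}$.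
   Formalization: The upper-mode claim is stated for r ≥ 1 and the two-mode criterion for r > 1: for r < 1 the integer ⌊(r−1)q/p⌋ is negative, so not a mode (r=1/2, p=1/3 gives endpoint −1 with one mode), and for r = 1 the endpoint is 0 but there is only one mode. *)

theory Defs
  imports "HOL-Analysis.Analysis"
begin

(* Negative binomial law NB(r,p) with real r > 0, counting failures; q = 1 - p. *)

definition nb_mass :: "real \<Rightarrow> real \<Rightarrow> nat \<Rightarrow> real" where
  "nb_mass r p k =
     Gamma (real k + r) / (Gamma r * Gamma (real k + 1)) * p powr r * (1 - p) ^ k"

definition nb_mean :: "real \<Rightarrow> real \<Rightarrow> real" where
  "nb_mean r p = r * (1 - p) / p"

definition nb_var :: "real \<Rightarrow> real \<Rightarrow> real" where
  "nb_var r p = r * (1 - p) / p\<^sup>2"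

definition nb_modes :: "real \<Rightarrow> real \<Rightarrow> nat set" where
  "nb_modes r p = {k. \<forall>j. nb_mass r p j \<le> nb_mass r p k}"

definition is_upper_mode :: "real \<Rightarrow> real \<Rightarrow> nat \<Rightarrow> bool" where
  "is_upper_mode r p k \<longleftrightarrow> k \<in> nb_modes r p \<and> (\<forall>j\<in>nb_modes r p. j \<le> k)"

(* The coefficients a_0, a_1, ... of the asymptotic expansion (in the sense of Poincare)
   f(r) ~ a_0 + a_1 / r + a_2 / r^2 + ... along F, where F refines r \<rightarrow> \<infinity>:
   a_n is the limit of r^n (f(r) - a_0 - ... - a_(n-1) / r^(n-1)).
   Lim is a definite description, so the value is meaningful only when the limits exist. *)

fun asymp_coeff :: "real filter \<Rightarrow> (real \<Rightarrow> real) \<Rightarrow> nat \<Rightarrow> real" where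
  "asymp_coeff F f n = Lim F (\<lambda>r. r ^ n * (f r - (\<Sum>j<n. asymp_coeff F f j / r ^ j)))"

declare asymp_coeff.simps [simp del]

(* log (sqrt (2 pi sigma^2) P(mu + t)); used only where mu + t is a nonnegative integer,
   so that the rounding is exact. *)

definition nb_log_mass :: "real \<Rightarrow> real \<Rightarrow> real \<Rightarrow> real" where
  "nb_log_mass p t r = ln (sqrt (2 * pi * nb_var r p) * nb_mass r p (nat \<lfloor>nb_mean r p + t\<rfloor>))"

(* For fixed t, r tends to infinity through the values for which mu + t is a nonnegative integer. *)

definition nb_lattice_at_top :: "real \<Rightarrow> real \<Rightarrow> real filter" where
  "nb_lattice_at_top p t = inf at_top (principal {r. nb_mean r p + t \<in> \<nat>})"

definition nb_A1 :: "real \<Rightarrow> real \<Rightarrow> real" where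
  "nb_A1 p t = asymp_coeff (nb_lattice_at_top p t) (nb_log_mass p t) 1"

definition B2 :: "real \<Rightarrow> real" where
  "B2 t = t\<^sup>2 - t + 1 / 6"

definition critical_point :: "(real \<Rightarrow> real) \<Rightarrow> real \<Rightarrow> bool" where
  "critical_point f t \<longleftrightarrow> (f has_real_derivative 0) (at t)"

definition nb_tc :: "real \<Rightarrow> real" where
  "nb_tc p = (THE t. critical_point (nb_A1 p) t)"

end

theory Submission
  imports Defs "HOL-Real_Asymp.Real_Asymp"
begin

text \<open>
  The theorem has an asymptotic half and an exact half, which meet in the number
  \<open>x = (r - 1) q / p\<close>.

  The asymptotic half identifies \<open>A\<^sub>1\<close>. Up to elementary factors the mass function is
  \<open>\<Gamma>(N + t) / (\<Gamma>(r) \<Gamma>(N q + t + 1))\<close> with \<open>N = r / p\<close>, because \<open>k = \<mu> + t = N q + t\<close> and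
  \<open>k + r = N + t\<close>. In each factor \<open>t\<close> is a bounded shift of a large argument, so the shifted
  Stirling formula with its first correction \<open>B\<^sub>2(a) / (2 z)\<close> applies
  (\<open>ln_Gamma_shifted_stirling\<close>). The leading terms cancel exactly against the factor
  \<open>sqrt (2 \<pi> \<sigma>\<^sup>2)\<close>, and the three corrections add up to
  \<open>(p B\<^sub>2(t) / 2 - 1 / 12 - p B\<^sub>2(t + 1) / (2 q)) / r\<close>. Since \<open>B\<^sub>2(t + 1) = B\<^sub>2(t) + 2 t\<close>,
  this is the asserted quadratic (\<open>nb_log_mass_tendsto\<close>, \<open>nb_A1_eq\<close>). Its vertex is found by
  differentiation, and \<open>\<mu> + t\<^sub>c + 1/2 = x\<close> is then algebra.

  The exact half is elementary. The ratio \<open>P(k + 1) / P(k) = (k + r) q / (k + 1)\<close> exceeds 1,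
  equals 1 or falls below 1 according to whether \<open>k + 1\<close> is smaller than, equal to or larger
  than \<open>x\<close>. Hence \<open>P\<close> rises up to \<open>x\<close> and falls afterwards, and for \<open>r \<ge> 1\<close> its modes are the
  natural numbers in the closed interval \<open>[x - 1, x]\<close> (\<open>nb_modes_eq\<close>). The largest of these is
  \<open>\<lfloor>x\<rfloor>\<close>, and when \<open>r > 1\<close>, so that \<open>x > 0\<close>, the interval contains two natural numbers exactly
  when \<open>x\<close> is an integer.
\<close>

section \<open>Stirling's formula with its first correction\<close>

text \<open>
  The limit of this function at infinity, \<open>ln (2 \<pi>) / 2\<close>, is the constant in Stirling's formula.
  The term \<open>1 / (12 x)\<close> belongs to the approximation so that the remainder tends to its limit
  faster than \<open>1 / x\<close>, as is needed to read off a coefficient of order \<open>1 / x\<close>.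
\<close>

definition stirling_remainder :: "real \<Rightarrow> real" where
  "stirling_remainder x = ln (Gamma x) - ((x - 1/2) * ln x - x + 1 / (12 * x))"

lemma stirling_remainder_step:
  assumes "x > 0"
  shows "stirling_remainder x - stirling_remainder (x + 1)
           = (x + 1/2) * ln (1 + 1/x) - 1 - (1/12) * (1/x - 1/(x+1))"
proof -
  have "x \<notin> \<int>\<^sub>\<le>\<^sub>0"
    using assms by (auto elim!: nonpos_Ints_cases)
  then have Gamma: "ln (Gamma (x + 1)) = ln x + ln (Gamma x)"
    using assms Gamma_plus1[of x] by (simp add: ln_mult_pos \<open>x \<notin> \<int>\<^sub>\<le>\<^sub>0\<close>)
  have ln: "ln (x + 1) = ln x + ln (1 + 1/x)"
    using assms ln_div[of "x + 1" x] by (simp add: add_divide_distrib)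
  show ?thesis
    unfolding stirling_remainder_def Gamma ln by (simp add: algebra_simps)
qed

text \<open>
  A single increment is of order \<open>1 / x\<^sup>4\<close>, hence eventually below the telescoping difference
  \<open>1 / x\<^sup>2 - 1 / (x + 1)\<^sup>2\<close>, which is of order \<open>1 / x\<^sup>3\<close>. Summing gives a bound that is uniform
  in the number of steps.
\<close>

lemma eventually_stirling_remainder_increment_le:
  "\<forall>\<^sub>F x in at_top. \<forall>n::nat.
     \<bar>stirling_remainder x - stirling_remainder (x + real n)\<bar> \<le> 1 / x\<^sup>2"
proof -
  have "\<forall>\<^sub>F x::real in at_top.
      \<bar>(x + 1/2) * ln (1 + 1/x) - 1 - (1/12) * (1/x - 1/(x+1))\<bar> \<le> 1/x^2 - 1/(x+1)^2"
    by real_asymp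
  then obtain x0 :: real where x0: "\<And>x. x \<ge> x0 \<Longrightarrow>
      \<bar>(x + 1/2) * ln (1 + 1/x) - 1 - (1/12) * (1/x - 1/(x+1))\<bar> \<le> 1/x^2 - 1/(x+1)^2"
    by (auto simp: eventually_at_top_linorder)
  have step: "\<bar>stirling_remainder x - stirling_remainder (x + 1)\<bar> \<le> 1/x^2 - 1/(x+1)^2"
    if "x \<ge> max 1 x0" for x
    using x0[of x] stirling_remainder_step[of x] that by auto
  have "\<bar>stirling_remainder x - stirling_remainder (x + real n)\<bar> \<le> 1 / x\<^sup>2 - 1 / (x + real n)\<^sup>2"
    if "x \<ge> max 1 x0" for x and n :: nat
  proof (induction n)
    case (Suc n)
    show ?case
      using Suc step[of "x + real n"] that by (simp add: algebra_simps)
  qed simp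
  then have "\<bar>stirling_remainder x - stirling_remainder (x + real n)\<bar> \<le> 1 / x\<^sup>2"
    if "x \<ge> max 1 x0" for x and n :: nat
    using that by (smt (verit) zero_le_divide_1_iff zero_le_power2)
  then show ?thesis
    unfolding eventually_at_top_linorder by blast
qed

text \<open>
  This is the logarithm of Gauss's product formula for \<open>\<Gamma>(x)\<close>. It ensures that the remainder has
  the same limit along every progression \<open>x, x + 1, x + 2, \<dots>\<close>, whatever the fractional part
  of \<open>x\<close>; the recurrence of \<open>\<Gamma>\<close> alone could not exclude a periodic factor.
\<close>

lemma ln_Gamma_shift_asymp:
  assumes "x > 0"
  shows "(\<lambda>n. ln (Gamma (x + real n)) - ln (Gamma (real n)) - x * ln (real n)) \<longlonglongrightarrow> 0"
proof -
  have x: "x \<notin> \<int>\<^sub>\<le>\<^sub>0"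
    using assms by (auto elim!: nonpos_Ints_cases)
  have "(\<lambda>n. ln (Gamma x) - ln (Gamma_series' x n)) \<longlonglongrightarrow> ln (Gamma x) - ln (Gamma x)"
    using Gamma_real_pos[OF assms] by (intro tendsto_intros Gamma_series'_LIMSEQ) auto
  moreover have "\<forall>\<^sub>F n in sequentially. ln (Gamma x) - ln (Gamma_series' x n)
      = ln (Gamma (x + real n)) - ln (Gamma (real n)) - x * ln (real n)"
    using eventually_gt_at_top[of 0]
  proof eventually_elim
    case (elim n)
    have "fact (n - 1) = Gamma (real n)"
      using elim Gamma_fact[of "n - 1", where 'a = real] by (simp add: of_nat_diff)
    moreover have "Gamma x > 0" "Gamma (real n) > 0" "Gamma (x + real n) > 0"
      using assms elim by auto
    ultimately show ?case
      by (simp add: Gamma_series'_def pochhammer_Gamma[OF x] ln_mult ln_div)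
  qed
  ultimately show ?thesis
    by (simp add: Lim_transform_eventually)
qed

lemma stirling_remainder_shift:
  assumes "x > 0"
  shows "(\<lambda>n. stirling_remainder (x + real n) - stirling_remainder (real n)) \<longlonglongrightarrow> 0"
proof -
  have "((\<lambda>y::real. x * ln y - ((x + y - 1/2) * ln (x + y) - (x + y) + 1 / (12 * (x + y)))
          + ((y - 1/2) * ln y - y + 1 / (12 * y))) \<longlongrightarrow> 0) at_top"
    by real_asymp
  from tendsto_add[OF ln_Gamma_shift_asymp[OF assms]
      filterlim_compose[OF this filterlim_real_sequentially]]
  show ?thesis
    by (simp add: stirling_remainder_def algebra_simps)
qed

text \<open>
  The uniform bound on increments makes the remainder Cauchy along the natural numbers. The
  same bound, with the number of steps sent to infinity, gives the rate for real arguments.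
\<close>

lemma stirling_remainder_limit_exists:
  "\<exists>c. \<forall>\<^sub>F x in at_top. \<bar>stirling_remainder x - c\<bar> \<le> 1 / x\<^sup>2"
proof -
  obtain x0 where x0: "\<And>x n. x \<ge> x0 \<Longrightarrow>
      \<bar>stirling_remainder x - stirling_remainder (x + real n)\<bar> \<le> 1 / x\<^sup>2"
    using eventually_stirling_remainder_increment_le by (auto simp: eventually_at_top_linorder)
  have "Cauchy (\<lambda>n. stirling_remainder (real n))"
  proof (rule CauchyI')
    fix e :: real
    assume "e > 0"
    then have "\<forall>\<^sub>F x::real in at_top. 1 / x\<^sup>2 < e"
      by real_asymp
    then obtain x1 where x1: "\<And>x::real. x \<ge> x1 \<Longrightarrow> 1 / x\<^sup>2 < e"
      by (auto simp: eventually_at_top_linorder)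
    obtain M where M: "real M \<ge> max x0 x1"
      using real_arch_simple by blast
    show "\<exists>M. \<forall>m\<ge>M. \<forall>n>m.
        dist (stirling_remainder (real m)) (stirling_remainder (real n)) < e"
    proof (intro exI allI impI)
      fix m n
      assume "M \<le> m" "m < n"
      then obtain d where "n = m + d"
        using less_imp_add_positive by blast
      moreover have "real m \<ge> max x0 x1"
        using M \<open>M \<le> m\<close> by linarith
      ultimately show "dist (stirling_remainder (real m)) (stirling_remainder (real n)) < e"
        using x0[of "real m" d] x1[of "real m"] by (simp add: dist_real_def)
    qed
  qed
  then obtain c where c: "(\<lambda>n. stirling_remainder (real n)) \<longlonglongrightarrow> c"
    using Cauchy_convergent convergent_def by blast
  have "\<bar>stirling_remainder x - c\<bar> \<le> 1 / x\<^sup>2" if "x \<ge> max 1 x0" for x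
  proof (rule tendsto_upperbound)
    have "(\<lambda>n. stirling_remainder (x + real n)) \<longlonglongrightarrow> c"
      using tendsto_add[OF stirling_remainder_shift[of x] c] that by simp
    then show "(\<lambda>n. \<bar>stirling_remainder x - stirling_remainder (x + real n)\<bar>)
        \<longlonglongrightarrow> \<bar>stirling_remainder x - c\<bar>"
      by (intro tendsto_intros)
  qed (use x0 that in auto)
  then show ?thesis
    unfolding eventually_at_top_linorder by blast
qed

lemma ln_Gamma_duplication:
  fixes x :: real
  assumes "x > 0"
  shows "ln (Gamma x) + ln (Gamma (x + 1/2)) = (1 - 2 * x) * ln 2 + ln pi / 2 + ln (Gamma (2 * x))"
proof -
  have "complex_of_real x \<notin> \<int>\<^sub>\<le>\<^sub>0" "complex_of_real (x + 1/2) \<notin> \<int>\<^sub>\<le>\<^sub>0"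
    using assms by (auto simp: of_real_in_nonpos_Ints_iff elim!: nonpos_Ints_cases
        simp del: of_real_add)
  moreover have "Gamma (complex_of_real x + 1/2) = complex_of_real (Gamma (x + 1/2))"
    "Gamma (2 * complex_of_real x) = complex_of_real (Gamma (2 * x))"
    using Gamma_complex_of_real[of "x + 1/2"] Gamma_complex_of_real[of "2 * x"] by simp_all
  moreover have "exp ((1 - 2 * complex_of_real x) * complex_of_real (ln 2))
      = complex_of_real (exp ((1 - 2 * x) * ln 2))"
    by (simp flip: exp_of_real)
  ultimately have "complex_of_real (Gamma x * Gamma (x + 1/2))
      = complex_of_real (exp ((1 - 2 * x) * ln 2) * sqrt pi * Gamma (2 * x))"
    using Gamma_legendre_duplication[of "complex_of_real x"]
    by (simp add: Gamma_complex_of_real)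
  then have "Gamma x * Gamma (x + 1/2) = exp ((1 - 2 * x) * ln 2) * sqrt pi * Gamma (2 * x)"
    using of_real_eq_iff by blast
  moreover have "Gamma x > 0" "Gamma (x + 1/2) > 0" "Gamma (2 * x) > 0"
    using assms by auto
  ultimately show ?thesis
    by (metis (no_types) ln_mult_pos ln_exp ln_sqrt pi_gt_zero exp_gt_zero mult_pos_pos real_sqrt_gt_zero less_imp_le)
qed

text \<open>
  If \<open>c\<close> is the limit of the remainder \<open>D\<close>, then \<open>D(x) + D(x + 1/2) - D(2 x)\<close> tends to
  \<open>c + c - c = c\<close>. Legendre's duplication formula turns this combination into an elementary
  function, whose limit determines \<open>c\<close>.
\<close>

lemma eventually_stirling_remainder_le:
  "\<forall>\<^sub>F x in at_top. \<bar>stirling_remainder x - ln (2 * pi) / 2\<bar> \<le> 1 / x\<^sup>2"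
proof -
  obtain c where c: "\<forall>\<^sub>F x in at_top. \<bar>stirling_remainder x - c\<bar> \<le> 1 / x\<^sup>2"
    using stirling_remainder_limit_exists by blast
  have "((\<lambda>x. stirling_remainder x - c) \<longlongrightarrow> 0) at_top"
  proof (rule Lim_null_comparison)
    show "((\<lambda>x::real. 1 / x\<^sup>2) \<longlongrightarrow> 0) at_top"
      by real_asymp
  qed (use c in simp)
  then have lim: "(stirling_remainder \<longlongrightarrow> c) at_top"
    by (simp add: LIM_zero_iff)
  have "filterlim (\<lambda>x::real. x + 1/2) at_top at_top" "filterlim (\<lambda>x::real. 2 * x) at_top at_top"
    by real_asymp+
  then have "((\<lambda>x. stirling_remainder x + stirling_remainder (x + 1/2) - stirling_remainder (2 * x))
      \<longlongrightarrow> c + c - c) at_top"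
    by (intro tendsto_intros lim filterlim_compose[OF lim])
  moreover have "((\<lambda>x. stirling_remainder x + stirling_remainder (x + 1/2) - stirling_remainder (2 * x))
      \<longlongrightarrow> ln (2 * pi) / 2) at_top"
  proof (rule Lim_transform_eventually)
    have "((\<lambda>x::real. x * (ln x - ln (x + 1/2)) + 1/2 - 1 / (12 * x) - 1 / (12 * (x + 1/2)) + 1 / (24 * x))
        \<longlongrightarrow> 0) at_top"
      by real_asymp
    from tendsto_add[OF tendsto_const this]
    show "((\<lambda>x::real. ln (2 * pi) / 2
        + (x * (ln x - ln (x + 1/2)) + 1/2 - 1 / (12 * x) - 1 / (12 * (x + 1/2)) + 1 / (24 * x)))
        \<longlongrightarrow> ln (2 * pi) / 2) at_top"
      by simp
    show "\<forall>\<^sub>F x in at_top. ln (2 * pi) / 2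
        + (x * (ln x - ln (x + 1/2)) + 1/2 - 1 / (12 * x) - 1 / (12 * (x + 1/2)) + 1 / (24 * x))
        = stirling_remainder x + stirling_remainder (x + 1/2) - stirling_remainder (2 * x)"
      using eventually_gt_at_top[of 0]
    proof eventually_elim
      case (elim x)
      then show ?case
        using ln_Gamma_duplication[of x]
        by (simp add: stirling_remainder_def ln_mult algebra_simps add_divide_distrib)
    qed
  qed
  ultimately have "c = ln (2 * pi) / 2"
    using tendsto_unique trivial_limit_at_top_linorder by fastforce
  with c show ?thesis
    by simp
qed

text \<open>
  Stirling's formula at \<open>x + a\<close>, re-expanded in powers of \<open>x\<close> through \<open>ln (1 + a / x)\<close>. The
  coefficient of \<open>1 / x\<close> is \<open>(a - 1/2) a - a\<^sup>2 / 2 + 1 / 12 = B\<^sub>2(a) / 2\<close>.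
\<close>

lemma ln_Gamma_shifted_stirling:
  "((\<lambda>x. x * (ln (Gamma (x + a))
      - ((x + a - 1/2) * ln x - x + ln (2 * pi) / 2 + B2 a / (2 * x)))) \<longlongrightarrow> 0) at_top"
proof (rule Lim_transform_eventually)
  have "((\<lambda>x. x * (stirling_remainder (x + a) - ln (2 * pi) / 2)) \<longlongrightarrow> 0) at_top"
  proof (rule Lim_null_comparison)
    have "filterlim (\<lambda>x::real. x + a) at_top at_top"
      by real_asymp
    then have "\<forall>\<^sub>F x in at_top. \<bar>stirling_remainder (x + a) - ln (2 * pi) / 2\<bar> \<le> 1 / (x + a)\<^sup>2"
      by (rule eventually_compose_filterlim[OF eventually_stirling_remainder_le])
    then show "\<forall>\<^sub>F x in at_top. norm (x * (stirling_remainder (x + a) - ln (2 * pi) / 2))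
        \<le> x * (1 / (x + a)\<^sup>2)"
      using eventually_gt_at_top[of 0]
    proof eventually_elim
      case (elim x)
      then show ?case
        unfolding real_norm_def abs_mult by (intro mult_mono) auto
    qed
    show "((\<lambda>x::real. x * (1 / (x + a)\<^sup>2)) \<longlongrightarrow> 0) at_top"
      by real_asymp
  qed
  moreover have "((\<lambda>x. x * ((x + a - 1/2) * ln (1 + a / x) - a + 1 / (12 * (x + a))
      - (a\<^sup>2 - a + 1/6) / (2 * x))) \<longlongrightarrow> 0) at_top"
    by real_asymp (simp add: power2_eq_square field_simps)
  ultimately show "((\<lambda>x. x * (stirling_remainder (x + a) - ln (2 * pi) / 2)
      + x * ((x + a - 1/2) * ln (1 + a / x) - a + 1 / (12 * (x + a))
      - (a\<^sup>2 - a + 1/6) / (2 * x))) \<longlongrightarrow> 0) at_top"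
    using tendsto_add by fastforce
  show "\<forall>\<^sub>F x in at_top. x * (stirling_remainder (x + a) - ln (2 * pi) / 2)
      + x * ((x + a - 1/2) * ln (1 + a / x) - a + 1 / (12 * (x + a))
      - (a\<^sup>2 - a + 1/6) / (2 * x))
      = x * (ln (Gamma (x + a))
      - ((x + a - 1/2) * ln x - x + ln (2 * pi) / 2 + B2 a / (2 * x)))"
    using eventually_gt_at_top[of "max 0 (- a)"]
  proof eventually_elim
    case (elim x)
    then have ln: "ln (x + a) = ln x + ln (1 + a / x)"
      using ln_div[of "x + a" x] by (simp add: add_divide_distrib)
    show ?case
      unfolding stirling_remainder_def B2_def ln by (simp add: algebra_simps)
  qed
qed

section \<open>The first coefficient of the expansion\<close>

lemma nb_log_mass_eq:
  assumes "0 < p" "p < 1" "r > 0" "nb_mean r p + t \<in> \<nat>" "r / p + t > 0"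
  shows "nb_log_mass p t r = (ln (2 * pi) + ln r + ln (1 - p) - 2 * ln p) / 2
    + ln (Gamma (r / p + t)) - ln (Gamma r) - ln (Gamma (r * (1 - p) / p + (t + 1)))
    + r * ln p + (r * (1 - p) / p + t) * ln (1 - p)"
proof -
  obtain k :: nat where k: "nb_mean r p + t = real k"
    using assms(4) by (auto elim: Nats_cases)
  then have k': "r * (1 - p) / p + t = real k"
    by (simp add: nb_mean_def)
  have kr: "real k + r = r / p + t"
    using assms by (simp add: field_simps flip: k')
  have pos: "Gamma r > 0" "Gamma (real k + 1) > 0" "Gamma (r / p + t) > 0"
    using assms by (auto intro!: Gamma_real_pos)
  then have nz: "Gamma r \<noteq> 0" "Gamma (real k + 1) \<noteq> 0" "Gamma (r / p + t) \<noteq> 0"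
    by linarith+
  have ln_mass: "ln (nb_mass r p k) = ln (Gamma (r / p + t)) - ln (Gamma r)
      - ln (Gamma (real k + 1)) + r * ln p + real k * ln (1 - p)"
    unfolding nb_mass_def kr
    using nz assms by (simp add: ln_mult ln_div ln_powr ln_realpow)
  have "nb_mass r p k > 0" "nb_var r p > 0"
    unfolding nb_mass_def nb_var_def kr using pos assms by simp_all
  then have "nb_log_mass p t r = ln (sqrt (2 * pi * nb_var r p)) + ln (nb_mass r p k)"
    unfolding nb_log_mass_def k by (simp add: ln_mult_pos del: ln_sqrt)
  also have "ln (sqrt (2 * pi * nb_var r p)) = (ln (2 * pi) + ln r + ln (1 - p) - 2 * ln p) / 2"
    using assms by (simp add: nb_var_def ln_sqrt ln_mult ln_div ln_realpow)
  finally have "nb_log_mass p t r = (ln (2 * pi) + ln r + ln (1 - p) - 2 * ln p) / 2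
      + ln (nb_mass r p k)" .
  moreover have "r * (1 - p) / p + (t + 1) = real k + 1"
    using k' by simp
  ultimately show ?thesis
    by (simp only: ln_mass k')
qed

text \<open>
  The shifted Stirling formula is applied at \<open>r / p\<close> with shift \<open>t\<close>, at \<open>r\<close> with shift \<open>0\<close>, and
  at \<open>r q / p\<close> with shift \<open>t + 1\<close>. Since \<open>r / p = r + r q / p\<close>, all terms of order
  \<open>r ln r\<close>, \<open>r\<close>, \<open>ln r\<close> and \<open>1\<close> cancel identically. There is no constant term left, so
  multiplication by \<open>r\<close> isolates the coefficient of \<open>1 / r\<close>.
\<close>

lemma nb_log_mass_tendsto:
  assumes p: "0 < p" "p < 1" and q: "q = 1 - p"
  shows "((\<lambda>r. r * nb_log_mass p t r) \<longlongrightarrow>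
           - (p\<^sup>2 / (2 * q)) * B2 t - p / q * t - 1 / 12) (nb_lattice_at_top p t)"
    (is "(_ \<longlongrightarrow> ?A) _")
proof -
  \<comment> \<open>the error of the shifted Stirling formula, which is of smaller order than \<open>1 / x\<close>\<close>
  define E where "E a x = ln (Gamma (x + a))
      - ((x + a - 1/2) * ln x - x + ln (2 * pi) / 2 + B2 a / (2 * x))" for a x :: real
  have E: "((\<lambda>x. x * E a x) \<longlongrightarrow> 0) at_top" for a
    unfolding E_def by (rule ln_Gamma_shifted_stirling)
  have "q > 0"
    using p q by simp
  have 1: "filterlim (\<lambda>r. r / p) at_top at_top"
    using p by real_asymp
  have 2: "filterlim (\<lambda>r. r * q / p) at_top at_top"
    using p \<open>q > 0\<close> by real_asymp
  have "((\<lambda>r. ?A + p * (r / p * E t (r / p)) - r * E 0 r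
      - p / q * (r * q / p * E (t + 1) (r * q / p))) \<longlongrightarrow> ?A + p * 0 - 0 - p / q * 0) at_top"
    by (intro tendsto_intros E filterlim_compose[OF E 1] filterlim_compose[OF E 2])
  then have "((\<lambda>r. ?A + p * (r / p * E t (r / p)) - r * E 0 r
      - p / q * (r * q / p * E (t + 1) (r * q / p))) \<longlongrightarrow> ?A) (nb_lattice_at_top p t)"
    unfolding nb_lattice_at_top_def by (intro tendsto_mono[OF inf_le1]) simp
  moreover have "\<forall>\<^sub>F r in nb_lattice_at_top p t.
      ?A + p * (r / p * E t (r / p)) - r * E 0 r
      - p / q * (r * q / p * E (t + 1) (r * q / p)) = r * nb_log_mass p t r"
  proof -
    have "\<forall>\<^sub>F r in at_top. r / p + t > 0"
      using p by real_asymp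
    then have "\<forall>\<^sub>F r in at_top. nb_mean r p + t \<in> \<nat> \<longrightarrow> r > 0 \<and> r / p + t > 0 \<and> nb_mean r p + t \<in> \<nat>"
      using eventually_gt_at_top[of 0] by eventually_elim auto
    then have "\<forall>\<^sub>F r in nb_lattice_at_top p t. r > 0 \<and> r / p + t > 0 \<and> nb_mean r p + t \<in> \<nat>"
      by (simp add: nb_lattice_at_top_def eventually_inf_principal)
    then show ?thesis
    proof eventually_elim
      case (elim r)
      \<comment> \<open>With \<open>M = r q / p\<close> in place of the quotient, and \<open>r / p\<close> replaced by \<open>r + M\<close>,
        the cancellation of the leading terms is a linear identity in the logarithms.\<close>
      define M where "M = r * q / p"
      have N: "r / p = r + M"
        using p by (simp add: M_def q field_simps)
      have "M > 0"
        using elim p \<open>q > 0\<close> by (simp add: M_def)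
      have lnN: "ln (r + M) = ln r - ln p"
        using elim p by (simp flip: N add: ln_div)
      have lnM: "ln M = ln r + ln q - ln p"
        using elim p \<open>q > 0\<close> by (simp add: M_def ln_div ln_mult)
      have "nb_log_mass p t r = (ln (2 * pi) + ln r + ln q - 2 * ln p) / 2
          + ln (Gamma (r + M + t)) - ln (Gamma r) - ln (Gamma (M + (t + 1)))
          + r * ln p + (M + t) * ln q"
        using nb_log_mass_eq[of p r t] elim p by (simp add: q[symmetric] N flip: M_def)
      also have "\<dots> = E t (r + M) - E 0 r - E (t + 1) M
          + (B2 t / (2 * (r + M)) - B2 0 / (2 * r) - B2 (t + 1) / (2 * M))"
        unfolding E_def lnN lnM by (simp add: field_simps)
      also have "B2 t / (2 * (r + M)) - B2 0 / (2 * r) - B2 (t + 1) / (2 * M) = ?A / r"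
      proof -
        have B: "B2 (t + 1) = B2 t + 2 * t" "B2 0 = 1/6"
          by (simp_all add: B2_def power2_eq_square algebra_simps)
        have "p * B2 t / 2 - 1/12 - p * (B2 t + 2 * t) / (2 * q) = ?A"
        proof -
          have "p = 1 - q"
            using q by simp
          then show ?thesis
            using \<open>q > 0\<close> by (simp only:) (simp add: field_simps power2_eq_square)
        qed
        moreover have "B2 t / (2 * (r + M)) - B2 0 / (2 * r) - B2 (t + 1) / (2 * M)
            = (p * B2 t / 2 - 1/12 - p * (B2 t + 2 * t) / (2 * q)) / r"
        proof -
          have "B2 t / (2 * (r / p)) - 1/6 / (2 * r) - (B2 t + 2 * t) / (2 * (r * q / p))
            = (p * B2 t / 2 - 1/12 - p * (B2 t + 2 * t) / (2 * q)) / r"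
            using \<open>q > 0\<close> p elim by (simp add: field_simps)
          then show ?thesis
            unfolding B N[symmetric] by (simp only: M_def)
        qed
        ultimately show ?thesis by simp
      qed
      finally have *: "nb_log_mass p t r = E t (r + M) - E 0 r - E (t + 1) M + ?A / r" .
      show ?case
      proof -
        have "r * (X - Y - Z + a / r) = a + p * (r / p * X) - r * Y - p / q * (r * q / p * Z)"
          for X Y Z a
          using elim p \<open>q > 0\<close> by (simp add: field_simps)
        then show ?thesis
          unfolding * M_def[symmetric] N[symmetric] by simp
      qed
    qed
  qed
  ultimately show ?thesis
    by (rule Lim_transform_eventually)
qed

text \<open>
  A limit along this filter is unique, hence equal to the value of \<^const>\<open>Lim\<close>, only because
  arbitrarily large \<open>r\<close> make \<open>\<mu> + t\<close> a natural number, namely \<open>r = (n - t) p / q\<close> for large \<open>n\<close>.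
\<close>

lemma nb_lattice_at_top_nontrivial:
  assumes "0 < p" "p < 1"
  shows "nb_lattice_at_top p t \<noteq> bot"
proof -
  have "filterlim (\<lambda>n. (real n - t) * p / (1 - p)) at_top sequentially"
    using assms by real_asymp
  moreover have "nb_mean ((real n - t) * p / (1 - p)) p + t \<in> \<nat>" for n
    using assms by (simp add: nb_mean_def)
  ultimately have "filterlim (\<lambda>n. (real n - t) * p / (1 - p)) (nb_lattice_at_top p t) sequentially"
    by (simp add: nb_lattice_at_top_def filterlim_inf filterlim_principal)
  then show ?thesis
    by (auto simp: filterlim_def bot_unique filtermap_bot_iff)
qed

text \<open>
  Convergence of \<open>r f(r)\<close> forces \<open>f(r) \<rightarrow> 0\<close>. Therefore the coefficient of order \<open>0\<close>, which is
  subtracted in the definition of the next one, vanishes.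
\<close>

lemma asymp_coeff_1_eq:
  assumes F: "F \<noteq> bot" "F \<le> at_top" and lim: "((\<lambda>r. r * f r) \<longlongrightarrow> a) F"
  shows "asymp_coeff F f 1 = a"
proof -
  have "((\<lambda>r::real. inverse r) \<longlongrightarrow> 0) F"
    using F(2) tendsto_inverse_0_at_top[OF filterlim_ident] by (rule tendsto_mono)
  from tendsto_mult[OF this lim] have "((\<lambda>r. inverse r * (r * f r)) \<longlongrightarrow> 0) F"
    by simp
  moreover have "\<forall>\<^sub>F r in F. inverse r * (r * f r) = f r"
    using filter_leD[OF F(2) eventually_gt_at_top[of 0]] by eventually_elim simp
  ultimately have "(f \<longlongrightarrow> 0) F"
    by (rule Lim_transform_eventually)
  then have zero: "asymp_coeff F f 0 = 0"
    using F(1) by (subst asymp_coeff.simps) (simp add: tendsto_Lim)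
  show "asymp_coeff F f 1 = a"
    using F(1) lim by (subst asymp_coeff.simps) (simp add: zero tendsto_Lim)
qed

lemma nb_A1_eq:
  assumes "0 < p" "p < 1" "q = 1 - p"
  shows "nb_A1 p t = - (p\<^sup>2 / (2 * q)) * B2 t - p / q * t - 1 / 12"
  unfolding nb_A1_def
  by (rule asymp_coeff_1_eq[OF nb_lattice_at_top_nontrivial _ nb_log_mass_tendsto])
    (use assms in \<open>auto simp: nb_lattice_at_top_def\<close>)

lemma critical_point_nb_A1_iff:
  assumes "0 < p" "p < 1" "q = 1 - p"
  shows "critical_point (nb_A1 p) t \<longleftrightarrow> t = - (q / p) - 1 / 2"
proof -
  have "q > 0"
    using assms by simp
  have "nb_A1 p = (\<lambda>t. - (p\<^sup>2 / (2 * q)) * (t\<^sup>2 - t + 1 / 6) - p / q * t - 1 / 12)"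
    using nb_A1_eq[OF assms] by (simp add: fun_eq_iff B2_def)
  then have deriv: "(nb_A1 p has_real_derivative - (p\<^sup>2 / (2 * q)) * (2 * t - 1) - p / q) (at t)"
    using \<open>q > 0\<close> by (auto intro!: derivative_eq_intros)
  have "critical_point (nb_A1 p) t \<longleftrightarrow> - (p\<^sup>2 / (2 * q)) * (2 * t - 1) - p / q = 0"
    unfolding critical_point_def using deriv DERIV_unique by metis
  also have "- (p\<^sup>2 / (2 * q)) * (2 * t - 1) - p / q = - (p\<^sup>2 / q) * (t - (- (q / p) - 1 / 2))"
  proof -
    have qp: "q / p = 1 / p - 1"
      using assms(1) by (simp add: assms(3) diff_divide_distrib)
    show ?thesis
      unfolding qp using assms(1) \<open>q > 0\<close> by (simp add: field_simps power2_eq_square)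
  qed
  finally show ?thesis
    using assms by simp
qed

section \<open>Modes\<close>

lemma nb_mass_Suc:
  assumes "r > 0"
  shows "nb_mass r p (Suc k) * (real k + 1) = nb_mass r p k * ((real k + r) * (1 - p))"
proof -
  have "real k + r \<notin> \<int>\<^sub>\<le>\<^sub>0" "real k + 1 \<notin> \<int>\<^sub>\<le>\<^sub>0"
    using assms by (auto elim!: nonpos_Ints_cases)
  then have "Gamma (real (Suc k) + r) = (real k + r) * Gamma (real k + r)"
    "Gamma (real (Suc k) + 1) = (real k + 1) * Gamma (real k + 1)"
    using Gamma_plus1[of "real k + r"] Gamma_plus1[of "real k + 1"] by (simp_all add: add_ac)
  moreover have "a * g / (h * (c * d)) * P * (s * Q) * c = g / (h * d) * P * Q * (a * s)"
    if "c \<noteq> 0" for a c d g h s P Q :: real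
    using that by (simp add: ac_simps)
  ultimately show ?thesis
    unfolding nb_mass_def by simp
qed

lemma nb_mass_pos:
  assumes "r > 0" "0 < p" "p < 1"
  shows "nb_mass r p k > 0"
  unfolding nb_mass_def using assms by (auto intro!: mult_pos_pos divide_pos_pos Gamma_real_pos)

text \<open>
  The condition \<open>(k + r) q \<ge> k + 1\<close> on the ratio of consecutive masses is linear in \<open>k\<close>, and
  solving it for \<open>k + 1\<close> produces the threshold \<open>(r - 1) q / p\<close>.
\<close>

lemma nb_mass_Suc_iff:
  assumes "r > 0" "0 < p" "p < 1"
  shows "nb_mass r p k \<le> nb_mass r p (Suc k) \<longleftrightarrow> real (Suc k) \<le> (r - 1) * (1 - p) / p"
    and "nb_mass r p k < nb_mass r p (Suc k) \<longleftrightarrow> real (Suc k) < (r - 1) * (1 - p) / p"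
proof -
  have pos: "nb_mass r p k > 0"
    using assms by (rule nb_mass_pos)
  have Suc: "nb_mass r p (Suc k) = nb_mass r p k * ((real k + r) * (1 - p) / (real k + 1))"
    using nb_mass_Suc[OF assms(1), of p k] by (simp add: field_simps)
  have le: "nb_mass r p k \<le> nb_mass r p k * z \<longleftrightarrow> 1 \<le> z"
    and less: "nb_mass r p k < nb_mass r p k * z \<longleftrightarrow> 1 < z" for z
    using mult_le_cancel_left_pos[OF pos, of 1 z] mult_less_cancel_left_pos[OF pos, of 1 z] by simp_all
  have "nb_mass r p k \<le> nb_mass r p (Suc k) \<longleftrightarrow> 1 \<le> (real k + r) * (1 - p) / (real k + 1)"
    unfolding Suc by (rule le)
  also have "\<dots> \<longleftrightarrow> real (Suc k) \<le> (r - 1) * (1 - p) / p"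
    using assms by (simp add: field_simps)
  finally show "nb_mass r p k \<le> nb_mass r p (Suc k) \<longleftrightarrow> real (Suc k) \<le> (r - 1) * (1 - p) / p" .
  have "nb_mass r p k < nb_mass r p (Suc k) \<longleftrightarrow> 1 < (real k + r) * (1 - p) / (real k + 1)"
    unfolding Suc by (rule less)
  also have "\<dots> \<longleftrightarrow> real (Suc k) < (r - 1) * (1 - p) / p"
    using assms by (simp add: field_simps)
  finally show "nb_mass r p k < nb_mass r p (Suc k) \<longleftrightarrow> real (Suc k) < (r - 1) * (1 - p) / p" .
qed

text \<open>
  The sequence rises weakly up to index \<open>\<lfloor>x\<rfloor>\<close> and falls weakly from index \<open>\<lceil>x\<rceil> - 1\<close> on; a
  plateau occurs only between \<open>x - 1\<close> and \<open>x\<close>. The alternative \<open>k = 0\<close> covers a negative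
  threshold, where the sequence falls from the start.
\<close>

lemma unimodal_maximizers:
  fixes f :: "nat \<Rightarrow> real"
  assumes le: "\<And>k. f k \<le> f (Suc k) \<longleftrightarrow> real (Suc k) \<le> x"
    and less: "\<And>k. f k < f (Suc k) \<longleftrightarrow> real (Suc k) < x"
  shows "{k. \<forall>j. f j \<le> f k} = {k. x - 1 \<le> real k \<and> (k = 0 \<or> real k \<le> x)}"
proof (intro subset_antisym subsetI CollectI)
  fix k
  assume "k \<in> {k. \<forall>j. f j \<le> f k}"
  then have max: "f j \<le> f k" for j
    by simp
  have "x \<le> real (Suc k)"
    using max[of "Suc k"] less[of k] by linarith
  moreover have "k = 0 \<or> real k \<le> x"
  proof (cases k)
    case (Suc i)
    then show ?thesis
      using max[of i] le[of i] by blast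
  qed simp
  ultimately show "x - 1 \<le> real k \<and> (k = 0 \<or> real k \<le> x)"
    by simp
next
  fix k
  assume "k \<in> {k. x - 1 \<le> real k \<and> (k = 0 \<or> real k \<le> x)}"
  then have lower: "x \<le> real (Suc k)" and upper: "k = 0 \<or> real k \<le> x"
    by simp_all
  show "\<forall>j. f j \<le> f k"
  proof
    fix j
    show "f j \<le> f k"
    proof (cases "j \<le> k")
      case True
      then show ?thesis
      proof (induction rule: inc_induct)
        case (step i)
        then have "real (Suc i) \<le> x"
          using upper by linarith
        then have "f i \<le> f (Suc i)"
          by (rule iffD2[OF le])
        then show ?case
          using step.IH by (rule order_trans)
      qed simp
    next
      case False
      then have "k \<le> j" by simp
      then show ?thesis
      proof (induction rule: dec_induct)
        case (step i)
        then have "\<not> real (Suc i) < x"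
          using lower by linarith
        then have "f (Suc i) \<le> f i"
          using less[of i] by linarith
        then show ?case
          using step.IH by (rule order_trans)
      qed simp
    qed
  qed
qed

lemma nb_modes_eq:
  assumes "r \<ge> 1" "0 < p" "p < 1"
  shows "nb_modes r p = {k. (r - 1) * (1 - p) / p - 1 \<le> real k \<and> real k \<le> (r - 1) * (1 - p) / p}"
proof -
  have "(r - 1) * (1 - p) / p \<ge> 0"
    using assms by simp
  moreover have "r > 0"
    using assms by simp
  ultimately show ?thesis
    unfolding nb_modes_def unimodal_maximizers[OF nb_mass_Suc_iff[OF \<open>r > 0\<close> assms(2,3)]]
    by auto
qed

lemma nat_floor_upper_mode:
  assumes "r \<ge> 1" "0 < p" "p < 1"
  shows "is_upper_mode r p (nat \<lfloor>(r - 1) * (1 - p) / p\<rfloor>)"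
proof -
  have "(r - 1) * (1 - p) / p \<ge> 0"
    using assms by simp
  then show ?thesis
    unfolding is_upper_mode_def nb_modes_eq[OF assms]
    by (auto simp: le_nat_floor)
qed

lemma card_nat_unit_interval_eq_2_iff:
  fixes x :: real
  assumes "x > 0"
  shows "card {k::nat. x - 1 \<le> real k \<and> real k \<le> x} = 2 \<longleftrightarrow> x \<in> \<int>"
proof (cases "x \<in> \<int>")
  case True
  then obtain i :: int where i: "x = of_int i"
    by (rule Ints_cases)
  with assms obtain n where "i = int (Suc n)"
    by (metis of_int_0_less_iff pos_int_cases gr0_implies_Suc)
  with i have n: "x = real (Suc n)"
    by simp
  have "{k::nat. x - 1 \<le> real k \<and> real k \<le> x} = {n, Suc n}"
    unfolding n by auto
  with True show ?thesis by simp
next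
  case False
  have "{k::nat. x - 1 \<le> real k \<and> real k \<le> x} = {nat \<lfloor>x\<rfloor>}"
  proof (intro set_eqI iffI)
    fix k
    assume k: "k \<in> {k::nat. x - 1 \<le> real k \<and> real k \<le> x}"
    have "x - 1 \<noteq> real k"
      using False by (metis Ints_1 Ints_add Ints_of_nat diff_add_cancel)
    with k have "\<lfloor>x\<rfloor> = int k"
      by (auto intro!: floor_unique)
    then show "k \<in> {nat \<lfloor>x\<rfloor>}" by simp
  next
    fix k
    assume "k \<in> {nat \<lfloor>x\<rfloor>}"
    then show "k \<in> {k::nat. x - 1 \<le> real k \<and> real k \<le> x}"
      using assms by (auto; linarith)
  qed
  with False show ?thesis by simp
qed

theorem theorem4p4:
  fixes r p q \<mu> :: real
  assumes "r > 0" and "0 < p" and "p < 1"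
    and "q = 1 - p" and "\<mu> = nb_mean r p"
  shows
    "(\<forall>t. nb_A1 p t = - (p\<^sup>2 / (2 * q)) * B2 t - p / q * t - 1 / 12)
   \<and> (\<exists>!t. critical_point (nb_A1 p) t)
   \<and> nb_tc p = - ((1 + q) / (2 * p))
   \<and> nb_tc p = - (q / p) - 1 / 2
   \<and> \<mu> + nb_tc p + 1 / 2 = (r - 1) * q / p
   \<and> {m :: int. of_int m \<in> {\<mu> + nb_tc p - 1 / 2 <.. \<mu> + nb_tc p + 1 / 2}}
        = {\<lfloor>(r - 1) * q / p\<rfloor>}
   \<and> (r \<ge> 1 \<longrightarrow> (\<exists>m :: nat. int m = \<lfloor>(r - 1) * q / p\<rfloor> \<and> is_upper_mode r p m))
   \<and> (r > 1 \<longrightarrow> (card (nb_modes r p) = 2 \<longleftrightarrow> (r - 1) * q / p \<in> \<int>))"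
proof -
  note crit = critical_point_nb_A1_iff[OF assms(2,3,4)]
  have tc: "nb_tc p = - (q / p) - 1 / 2"
    unfolding nb_tc_def crit by simp
  have endpoint: "\<mu> + nb_tc p + 1 / 2 = (r - 1) * q / p"
    using assms(2,3) by (simp add: tc nb_mean_def assms(4,5) field_simps)
  have window: "{m :: int. of_int m \<in> {\<mu> + nb_tc p - 1 / 2 <.. \<mu> + nb_tc p + 1 / 2}}
      = {\<lfloor>(r - 1) * q / p\<rfloor>}"
    unfolding endpoint[symmetric]
    by (auto simp: floor_eq_iff) linarith+
  have upper: "\<exists>m :: nat. int m = \<lfloor>(r - 1) * q / p\<rfloor> \<and> is_upper_mode r p m" if "r \<ge> 1"
  proof -
    have "(r - 1) * q / p \<ge> 0"
      using that assms by simp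
    then show ?thesis
      using nat_floor_upper_mode[OF that assms(2,3)] assms(4)
      by (intro exI[of _ "nat \<lfloor>(r - 1) * q / p\<rfloor>"]) auto
  qed
  have two: "card (nb_modes r p) = 2 \<longleftrightarrow> (r - 1) * q / p \<in> \<int>" if "r > 1"
  proof -
    have "(r - 1) * q / p > 0"
      using that assms by simp
    then show ?thesis
      using nb_modes_eq[of r p] card_nat_unit_interval_eq_2_iff[of "(r - 1) * q / p"] that assms
      by simp
  qed
  have "nb_tc p = - ((1 + q) / (2 * p))"
    using assms(2) by (simp add: tc assms(4) field_simps)
  moreover have "\<exists>!t. critical_point (nb_A1 p) t"
    by (simp add: crit)
  ultimately show ?thesis
    by (intro conjI allI impI nb_A1_eq[OF assms(2,3,4)] tc endpoint window upper two)
qed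
end
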